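(* The category $\le\text{-}\mathbf{FCov}$ (of $\le$-formal covers) is equivalent to $\lhd\text{-}\mathbf{FCov}$ (of $\lhd$-formal covers), and hence to $\mathbf{FCov}$ (of formal covers).
   Context: A basic cover $(S,\lhd)$ on a set $S$ is a relation $\lhd$ between elements and subsets of $S$ such that $a\in U$ implies $a\lhd U$, and $a\lhd U$, $U\lhd V$ imply $a\lhd V$, where $U\lhd V$ means $b\lhd V$ for all $b\in U$. Put $\mathcal A U=\{a\in S\mid a\lhd U\}$; $U=_{\mathcal A}V$ means $\mathcal A U=\mathcal A V$. $Sat(\mathcal A)=\{U\subseteq S\mid U=\mathcal A U\}$ has joins $\bigvee^{\mathcal A}_i\mathcal A U_i=\mathcal A(\bigcup_iU_i)$. Elements are identified with singletons. For a relation $r$ between $S$ and $T$ and $V\subseteq T$, $r^-V=\{a\in S\mid\exists b\in V,\ a\,r\,b\}$. A basic cover map $r:(S,\lhd_S)\to(T,\lhd_T)$ is a relation between $S$ and $T$ such that $b\lhd_TV$ implies $r^-b\lhd_Sr^-V$; two are equal if $r_1^-b=_{\mathcal A_S}r_2^-b$ for all $b\in T$; composition is relational composition. A formal cover is $(S,\lhd,\circ)$ where $\lhd$ is a basic cover on $S$ and $\circ$ is a binary operation on $\mathcal P(S)$ such that: $U_1\lhd V_1$ and $U_2\lhd V_2$ imply $U_1\circ U_2\lhd V_1\circ V_2$; $(U\circ V)\circ W\lhd U\circ(V\circ W)$; $U\circ V\lhd V\circ U$; the operation $\mathcal A U\circ^{\mathcal A}\mathcal A V=\mathcal A(U\circ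 V)$ on $Sat(\mathcal A)$ distributes over arbitrary joins; and $\mathcal A(U\circ V)=\mathcal A U\cap\mathcal A V$ for all $U,V\subseteq S$. A formal cover map $r:(S,\lhd_S,\circ_S)\to(T,\lhd_T,\circ_T)$ is a basic cover map with $r^-(\{b_1\}\circ_T\{b_2\})=_{\mathcal A_S}(r^-b_1)\circ_S(r^-b_2)$ for all $b_1,b_2\in T$ and $r^-T=_{\mathcal A_S}S$; equality is equality of basic cover maps. $\mathbf{FCov}$ is the category of formal covers and formal cover maps. For a preorder $\le$ on $S$, put $u\downarrow_\le v=\{a\in S\mid a\le u\text{ and }a\le v\}$ and $U\downarrow_\le V=\bigcup_{u\in U,v\in V}u\downarrow_\le v$. $(S,\lhd)$ is a $\lhd$-formal cover if, for the preorder $a\le b\Leftrightarrow a\lhd\{b\}$ and $\downarrow=\downarrow_\le$, one has: $a\lhd U$ and $a\lhd V$ imply $a\lhd U\downarrow V$ (equivalently, $(S,\lhd,\downarrow)$ is a formal cover); $\lhd\text{-}\mathbf{FCov}$ is the full subcategory of $\mathbf{FCov}$ on the formal covers of the form $(S,\lhd,\downarrow)$. A $\le$-formal cover is a basic cover $(S,\lhd)$ with a preorder $\le$ on $S$ such that: ($\le$-left) $a\le b$ and $b\lhd U$ imply $a\lhd U$; ($\le$-right) $a\lhd U$ and $a\lhd V$ imply $a\lhd U\downarrow_\le V$. It is identified with the formal cover $(S,\lhd,\downarrow_\le)$, and $\le\text{-}\mathbf{FCov}$ is the full subcategory of $\mathbf{FCov}$ whose objects are the $\le$-formal covers. *)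

theory Defs
  imports "HOL-Library.FuncSet"
begin

section \<open>Categories and equivalence of categories\<close>

text \<open>
  Hom-sets are indexed by objects and need not be disjoint, so composition and the action of a
  functor on arrows carry the objects as arguments: \<open>Comp C X Y Z g f\<close> is the composite of
  \<open>f \<in> Hom C X Y\<close> and \<open>g \<in> Hom C Y Z\<close>.
\<close>

record ('o, 'm) precategory =
  Ob :: "'o set"
  Hom :: "'o \<Rightarrow> 'o \<Rightarrow> 'm set"
  Ident :: "'o \<Rightarrow> 'm"
  Comp :: "'o \<Rightarrow> 'o \<Rightarrow> 'o \<Rightarrow> 'm \<Rightarrow> 'm \<Rightarrow> 'm"

locale category =
  fixes C :: "('o, 'm) precategory"
  assumes Ident_in_Hom: "X \<in> Ob C \<Longrightarrow> Ident C X \<in> Hom C X X"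
    and Comp_in_Hom:
      "\<lbrakk>X \<in> Ob C; Y \<in> Ob C; Z \<in> Ob C; f \<in> Hom C X Y; g \<in> Hom C Y Z\<rbrakk>
        \<Longrightarrow> Comp C X Y Z g f \<in> Hom C X Z"
    and Comp_Ident_left:
      "\<lbrakk>X \<in> Ob C; Y \<in> Ob C; f \<in> Hom C X Y\<rbrakk> \<Longrightarrow> Comp C X Y Y (Ident C Y) f = f"
    and Comp_Ident_right:
      "\<lbrakk>X \<in> Ob C; Y \<in> Ob C; f \<in> Hom C X Y\<rbrakk> \<Longrightarrow> Comp C X X Y f (Ident C X) = f"
    and Comp_assoc:
      "\<lbrakk>W \<in> Ob C; X \<in> Ob C; Y \<in> Ob C; Z \<in> Ob C;
        f \<in> Hom C W X; g \<in> Hom C X Y; h \<in> Hom C Y Z\<rbrakk>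
        \<Longrightarrow> Comp C W X Z (Comp C X Y Z h g) f = Comp C W Y Z h (Comp C W X Y g f)"

definition full_subcategory :: "('o, 'm) precategory \<Rightarrow> 'o set \<Rightarrow> ('o, 'm) precategory" where
  "full_subcategory C A = C\<lparr>Ob := A\<rparr>"

record ('o, 'm, 'p, 'n) prefunctor =
  fobj :: "'o \<Rightarrow> 'p"
  fhom :: "'o \<Rightarrow> 'o \<Rightarrow> 'm \<Rightarrow> 'n"

locale is_functor =
  fixes C :: "('o, 'm) precategory" and D :: "('p, 'n) precategory"
    and F :: "('o, 'm, 'p, 'n) prefunctor"
  assumes fobj_in_Ob: "X \<in> Ob C \<Longrightarrow> fobj F X \<in> Ob D"
    and fhom_in_Hom:
      "\<lbrakk>X \<in> Ob C; Y \<in> Ob C; f \<in> Hom C X Y\<rbrakk>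
        \<Longrightarrow> fhom F X Y f \<in> Hom D (fobj F X) (fobj F Y)"
    and fhom_Ident: "X \<in> Ob C \<Longrightarrow> fhom F X X (Ident C X) = Ident D (fobj F X)"
    and fhom_Comp:
      "\<lbrakk>X \<in> Ob C; Y \<in> Ob C; Z \<in> Ob C; f \<in> Hom C X Y; g \<in> Hom C Y Z\<rbrakk>
        \<Longrightarrow> fhom F X Z (Comp C X Y Z g f) =
            Comp D (fobj F X) (fobj F Y) (fobj F Z) (fhom F Y Z g) (fhom F X Y f)"

definition id_functor :: "('o, 'm, 'o, 'm) prefunctor" where
  "id_functor = \<lparr>fobj = (\<lambda>X. X), fhom = (\<lambda>X Y f. f)\<rparr>"

definition comp_functor ::
  "('p, 'n, 'q, 'k) prefunctor \<Rightarrow> ('o, 'm, 'p, 'n) prefunctor \<Rightarrow> ('o, 'm, 'q, 'k) prefunctor"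
where
  "comp_functor G F =
    \<lparr>fobj = (\<lambda>X. fobj G (fobj F X)),
     fhom = (\<lambda>X Y f. fhom G (fobj F X) (fobj F Y) (fhom F X Y f))\<rparr>"

definition isomorphism :: "('o, 'm) precategory \<Rightarrow> 'o \<Rightarrow> 'o \<Rightarrow> 'm \<Rightarrow> bool" where
  "isomorphism C X Y f \<longleftrightarrow>
    f \<in> Hom C X Y \<and>
    (\<exists>g \<in> Hom C Y X. Comp C X Y X g f = Ident C X \<and> Comp C Y X Y f g = Ident C Y)"

definition natural_isomorphism ::
  "('o, 'm) precategory \<Rightarrow> ('p, 'n) precategory \<Rightarrow>
   ('o, 'm, 'p, 'n) prefunctor \<Rightarrow> ('o, 'm, 'p, 'n) prefunctor \<Rightarrow> ('o \<Rightarrow> 'n) \<Rightarrow> bool"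
where
  "natural_isomorphism C D F G \<eta> \<longleftrightarrow>
    (\<forall>X \<in> Ob C. isomorphism D (fobj F X) (fobj G X) (\<eta> X)) \<and>
    (\<forall>X \<in> Ob C. \<forall>Y \<in> Ob C. \<forall>f \<in> Hom C X Y.
      Comp D (fobj F X) (fobj F Y) (fobj G Y) (\<eta> Y) (fhom F X Y f) =
      Comp D (fobj F X) (fobj G X) (fobj G Y) (fhom G X Y f) (\<eta> X))"

definition equivalent_categories ::
  "('o, 'm) precategory \<Rightarrow> ('p, 'n) precategory \<Rightarrow> bool"
where
  "equivalent_categories C D \<longleftrightarrow>
    category C \<and> category D \<and>
    (\<exists>F G. is_functor C D F \<and> is_functor D C G \<and>
      (\<exists>\<eta>. natural_isomorphism C C id_functor (comp_functor G F) \<eta>) \<and>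
      (\<exists>\<epsilon>. natural_isomorphism D D (comp_functor F G) id_functor \<epsilon>))"


section \<open>Basic covers\<close>

text \<open>
  The underlying sets are arbitrary subsets \<open>S\<close> of a type.  A cover relates elements of \<open>S\<close> to
  subsets of \<open>S\<close> only, so that a cover on \<open>S\<close> is determined by its restriction to \<open>S\<close>.
\<close>

type_synonym 'a cover_rel = "'a \<Rightarrow> 'a set \<Rightarrow> bool"

definition covers_set :: "'a cover_rel \<Rightarrow> 'a set \<Rightarrow> 'a set \<Rightarrow> bool" where
  "covers_set cov U V \<longleftrightarrow> (\<forall>b \<in> U. cov b V)"

definition sat :: "'a set \<Rightarrow> 'a cover_rel \<Rightarrow> 'a set \<Rightarrow> 'a set" where
  "sat S cov U = {a \<in> S. cov a U}"

definition Sat :: "'a set \<Rightarrow> 'a cover_rel \<Rightarrow> 'a set set" where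
  "Sat S cov = {U. U \<subseteq> S \<and> U = sat S cov U}"

locale basic_cover =
  fixes S :: "'a set" and cov :: "'a cover_rel" (infix "\<lhd>" 50)
  assumes cover_dom: "a \<lhd> U \<Longrightarrow> a \<in> S \<and> U \<subseteq> S"
    and cover_refl: "\<lbrakk>U \<subseteq> S; a \<in> U\<rbrakk> \<Longrightarrow> a \<lhd> U"
    and cover_trans: "\<lbrakk>V \<subseteq> S; a \<lhd> U; covers_set cov U V\<rbrakk> \<Longrightarrow> a \<lhd> V"


section \<open>Formal covers\<close>

text \<open>
  Joins in \<open>Sat\<close> and the operation induced on \<open>Sat\<close>.  On saturated arguments these agree with
  the formulas in terms of generators, \<open>\<Or>\<^sub>i \<A> U\<^sub>i = \<A> (\<Union>\<^sub>i U\<^sub>i)\<close> and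
  \<open>\<A> U \<circ> \<A> V = \<A> (U \<circ> V)\<close>, the latter because \<open>\<circ>\<close> is monotone for the cover.
\<close>

definition sat_join :: "'a set \<Rightarrow> 'a cover_rel \<Rightarrow> 'a set set \<Rightarrow> 'a set" where
  "sat_join S cov \<W> = sat S cov (\<Union>\<W>)"

definition sat_op ::
  "'a set \<Rightarrow> 'a cover_rel \<Rightarrow> ('a set \<Rightarrow> 'a set \<Rightarrow> 'a set) \<Rightarrow> 'a set \<Rightarrow> 'a set \<Rightarrow> 'a set"
where
  "sat_op S cov opr U V = sat S cov (opr U V)"

locale formal_cover = basic_cover S cov
  for S :: "'a set" and cov :: "'a cover_rel" (infix "\<lhd>" 50) +
  fixes opr :: "'a set \<Rightarrow> 'a set \<Rightarrow> 'a set" (infixl "\<circ>\<circ>" 70)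
  assumes op_closed: "opr \<in> Pow S \<rightarrow>\<^sub>E Pow S \<rightarrow>\<^sub>E Pow S"
    and op_mono:
      "\<lbrakk>U1 \<subseteq> S; U2 \<subseteq> S; V1 \<subseteq> S; V2 \<subseteq> S; covers_set cov U1 V1; covers_set cov U2 V2\<rbrakk>
        \<Longrightarrow> covers_set cov (U1 \<circ>\<circ> U2) (V1 \<circ>\<circ> V2)"
    and op_assoc:
      "\<lbrakk>U \<subseteq> S; V \<subseteq> S; W \<subseteq> S\<rbrakk> \<Longrightarrow> covers_set cov ((U \<circ>\<circ> V) \<circ>\<circ> W) (U \<circ>\<circ> (V \<circ>\<circ> W))"
    and op_comm: "\<lbrakk>U \<subseteq> S; V \<subseteq> S\<rbrakk> \<Longrightarrow> covers_set cov (U \<circ>\<circ> V) (V \<circ>\<circ> U)"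
    and op_distrib_left:
      "\<lbrakk>U \<in> Sat S cov; \<W> \<subseteq> Sat S cov\<rbrakk>
        \<Longrightarrow> sat_op S cov opr U (sat_join S cov \<W>) =
            sat_join S cov ((\<lambda>V. sat_op S cov opr U V) ` \<W>)"
    and op_distrib_right:
      "\<lbrakk>U \<in> Sat S cov; \<W> \<subseteq> Sat S cov\<rbrakk>
        \<Longrightarrow> sat_op S cov opr (sat_join S cov \<W>) U =
            sat_join S cov ((\<lambda>V. sat_op S cov opr V U) ` \<W>)"
    and op_meet:
      "\<lbrakk>U \<subseteq> S; V \<subseteq> S\<rbrakk> \<Longrightarrow> sat S cov (U \<circ>\<circ> V) = sat S cov U \<inter> sat S cov V"

record 'a fcov =
  pts :: "'a set"
  cvr :: "'a cover_rel"
  cop :: "'a set \<Rightarrow> 'a set \<Rightarrow> 'a set"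

text \<open>
  A relation \<open>r\<close> between \<open>S\<close> and \<open>T\<close> is a subset of \<open>S \<times> T\<close>; the inverse image of \<open>V\<close>
  along it is \<open>r\<inverse> `` V\<close>.
\<close>

definition basic_cover_map :: "'a fcov \<Rightarrow> 'a fcov \<Rightarrow> ('a \<times> 'a) set \<Rightarrow> bool" where
  "basic_cover_map X Y r \<longleftrightarrow>
    r \<subseteq> pts X \<times> pts Y \<and>
    (\<forall>b V. cvr Y b V \<longrightarrow> covers_set (cvr X) (r\<inverse> `` {b}) (r\<inverse> `` V))"

definition formal_cover_map :: "'a fcov \<Rightarrow> 'a fcov \<Rightarrow> ('a \<times> 'a) set \<Rightarrow> bool" where
  "formal_cover_map X Y r \<longleftrightarrow>
    basic_cover_map X Y r \<and>
    (\<forall>b1 \<in> pts Y. \<forall>b2 \<in> pts Y.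
      sat (pts X) (cvr X) (r\<inverse> `` (cop Y {b1} {b2})) =
      sat (pts X) (cvr X) (cop X (r\<inverse> `` {b1}) (r\<inverse> `` {b2}))) \<and>
    sat (pts X) (cvr X) (r\<inverse> `` pts Y) = sat (pts X) (cvr X) (pts X)"

definition fcm_eq :: "'a fcov \<Rightarrow> 'a fcov \<Rightarrow> (('a \<times> 'a) set \<times> ('a \<times> 'a) set) set" where
  "fcm_eq X Y =
    {(r1, r2). formal_cover_map X Y r1 \<and> formal_cover_map X Y r2 \<and>
      (\<forall>b \<in> pts Y. sat (pts X) (cvr X) (r1\<inverse> `` {b}) = sat (pts X) (cvr X) (r2\<inverse> `` {b}))}"

text \<open>
  Since equality of formal cover maps is coarser than equality of relations, arrows are
  equivalence classes of relations.  Composition is induced by relational composition, which \<open>O\<close>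
  writes in diagrammatic order; that the composites of representatives form a single class is part
  of \<open>FCov\<close> being a category.
\<close>

definition FCov :: "('a fcov, ('a \<times> 'a) set set) precategory" where
  "FCov =
    \<lparr>Ob = {X. formal_cover (pts X) (cvr X) (cop X)},
     Hom = (\<lambda>X Y. Collect (formal_cover_map X Y) // fcm_eq X Y),
     Ident = (\<lambda>X. fcm_eq X X `` {Id_on (pts X)}),
     Comp = (\<lambda>X Y Z g f. fcm_eq X Z `` {r O s | r s. r \<in> f \<and> s \<in> g})\<rparr>"


section \<open>Formal covers given by a preorder\<close>

definition down :: "'a set \<Rightarrow> ('a \<times> 'a) set \<Rightarrow> 'a set \<Rightarrow> 'a set \<Rightarrow> 'a set" where
  "down S le U V = (\<Union>u \<in> U. \<Union>v \<in> V. {a \<in> S. (a, u) \<in> le \<and> (a, v) \<in> le})"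

definition down_op :: "'a set \<Rightarrow> ('a \<times> 'a) set \<Rightarrow> 'a set \<Rightarrow> 'a set \<Rightarrow> 'a set" where
  "down_op S le = (\<lambda>U \<in> Pow S. \<lambda>V \<in> Pow S. down S le U V)"

definition cover_le :: "'a set \<Rightarrow> 'a cover_rel \<Rightarrow> ('a \<times> 'a) set" where
  "cover_le S cov = {(a, b). a \<in> S \<and> b \<in> S \<and> cov a {b}}"

locale cov_formal_cover = basic_cover S cov
  for S :: "'a set" and cov :: "'a cover_rel" (infix "\<lhd>" 50) +
  assumes cov_right: "\<lbrakk>a \<lhd> U; a \<lhd> V\<rbrakk> \<Longrightarrow> a \<lhd> down S (cover_le S cov) U V"

locale le_formal_cover = basic_cover S cov
  for S :: "'a set" and cov :: "'a cover_rel" (infix "\<lhd>" 50) +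
  fixes le :: "('a \<times> 'a) set"
  assumes le_preorder: "preorder_on S le"
    and le_left: "\<lbrakk>(a, b) \<in> le; b \<lhd> U\<rbrakk> \<Longrightarrow> a \<lhd> U"
    and le_right: "\<lbrakk>a \<lhd> U; a \<lhd> V\<rbrakk> \<Longrightarrow> a \<lhd> down S le U V"

definition cov_FCov :: "('a fcov, ('a \<times> 'a) set set) precategory" where
  "cov_FCov = full_subcategory FCov
    {\<lparr>pts = S, cvr = cv, cop = down_op S (cover_le S cv)\<rparr> | S cv. cov_formal_cover S cv}"

text \<open>
  Identifying \<open>(S, cv, le)\<close> with \<open>(S, cv, down_op S le)\<close> loses nothing: \<open>(a, b) \<in> le\<close> iff
  \<open>a \<in> down_op S le {b} {b}\<close>.
\<close>

definition le_FCov :: "('a fcov, ('a \<times> 'a) set set) precategory" where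
  "le_FCov = full_subcategory FCov
    {\<lparr>pts = S, cvr = cv, cop = down_op S le\<rparr> | S cv le. le_formal_cover S cv le}"

lemma (in le_formal_cover) formal_cover_down_op: "formal_cover S cov (down_op S le)"
proof -
  have dS: "down S le U V \<subseteq> S" for U V by (auto simp: down_def)
  have le1: "(a, b) \<in> le \<Longrightarrow> b \<in> U \<Longrightarrow> U \<subseteq> S \<Longrightarrow> a \<lhd> U" for a b U
    using le_left cover_refl by blast
  have tr: "a \<lhd> U \<Longrightarrow> (\<And>b. b \<in> U \<Longrightarrow> b \<lhd> V) \<Longrightarrow> V \<subseteq> S \<Longrightarrow> a \<lhd> V" for a U V
    using cover_trans unfolding covers_set_def by blast
  have d1: "a \<lhd> U" "a \<lhd> V" if "a \<in> down S le U V" "U \<subseteq> S" "V \<subseteq> S" for a U V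
    using that le1 by (auto simp: down_def)
  have d2: "a \<lhd> down S le U V \<longleftrightarrow> a \<lhd> U \<and> a \<lhd> V" if "U \<subseteq> S" "V \<subseteq> S" for a U V
    using tr[of a "down S le U V" U] tr[of a "down S le U V" V] le_right[of a U V] d1 that
    by blast
  have op: "down_op S le U V = down S le U V" if "U \<subseteq> S" "V \<subseteq> S" for U V
    using that by (simp add: down_op_def)
  have satS: "sat S cov U \<subseteq> S" for U by (auto simp: sat_def)
  have sat_sat: "sat S cov (sat S cov U) = sat S cov U" if "U \<subseteq> S" for U
  proof -
    have "a \<lhd> sat S cov U \<longleftrightarrow> a \<lhd> U" for a
    proof
      assume "a \<lhd> sat S cov U" then show "a \<lhd> U" by (rule tr) (auto simp: sat_def that)
    next
      assume "a \<lhd> U" then show "a \<lhd> sat S cov U"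
        using that satS by (rule_tac tr) (auto simp: sat_def intro!: cover_refl)
    qed
    then show ?thesis by (simp add: sat_def)
  qed
  have dist: "sat_op S cov (down_op S le) U (sat_join S cov \<W>) =
              sat_join S cov ((\<lambda>V. sat_op S cov (down_op S le) U V) ` \<W>)"
    and comm: "sat_op S cov (down_op S le) U V = sat_op S cov (down_op S le) V U"
    if U: "U \<in> Sat S cov" and W: "\<W> \<subseteq> Sat S cov" and V: "V \<subseteq> S" for U V \<W>
  proof -
    have US: "U \<subseteq> S" and UA: "a \<lhd> U \<longleftrightarrow> a \<in> U" for a
      using U cover_dom by (auto simp: Sat_def sat_def)
    have WS: "\<And>V. V \<in> \<W> \<Longrightarrow> V \<subseteq> S" using W by (auto simp: Sat_def)
    have WA: "\<And>V a. V \<in> \<W> \<Longrightarrow> a \<lhd> V \<longleftrightarrow> a \<in> V"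
      using W cover_dom by (fastforce simp: Sat_def sat_def)
    have opW: "sat_op S cov (down_op S le) U V = U \<inter> V" if "V \<in> \<W>" for V
      using US WS[OF that] WA[OF that] by (auto simp: sat_op_def sat_def op d2 UA)
    have sS: "\<Union>\<W> \<subseteq> S" using WS by auto
    have jn: "sat S cov (sat S cov (\<Union>\<W>)) = sat S cov (\<Union>\<W>)"
      by (rule sat_sat[OF sS])
    have "sat_op S cov (down_op S le) U (sat_join S cov \<W>) = U \<inter> sat S cov (\<Union>\<W>)"
    proof -
      have "sat_op S cov (down_op S le) U (sat_join S cov \<W>) = U \<inter> sat S cov (sat S cov (\<Union>\<W>))"
        using US satS by (auto simp: sat_op_def sat_join_def sat_def[of _ _ "down _ _ _ _"] op d2 UA)
          (auto simp: sat_def)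
      then show ?thesis by (simp add: jn)
    qed
    also have "\<dots> = sat S cov (\<Union>((\<lambda>V. U \<inter> V) ` \<W>))"
    proof (intro equalityI subsetI)
      fix a assume a: "a \<in> U \<inter> sat S cov (\<Union>\<W>)"
      then have "a \<lhd> down S le U (\<Union>\<W>)"
        by (intro le_right) (auto simp: sat_def UA)
      then have "a \<lhd> \<Union>((\<lambda>V. U \<inter> V) ` \<W>)"
      proof (rule tr)
        fix b assume "b \<in> down S le U (\<Union>\<W>)"
        then obtain u v V where b: "u \<in> U" "V \<in> \<W>" "v \<in> V" "(b, u) \<in> le" "(b, v) \<in> le"
          by (auto simp: down_def)
        have "b \<in> U" using le1[OF b(4) b(1) US] by (simp add: UA)
        moreover have "b \<in> V" using le1[OF b(5) b(3) WS[OF b(2)]] b(2) by (simp add: WA)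
        moreover note \<open>V \<in> \<W>\<close>
        ultimately show "b \<lhd> \<Union>((\<lambda>V. U \<inter> V) ` \<W>)" using US by (intro cover_refl) auto
      qed (use US in auto)
      then show "a \<in> sat S cov (\<Union>((\<lambda>V. U \<inter> V) ` \<W>))" using cover_dom by (auto simp: sat_def)
    next
      fix a assume "a \<in> sat S cov (\<Union>((\<lambda>V. U \<inter> V) ` \<W>))"
      then have a: "a \<lhd> \<Union>((\<lambda>V. U \<inter> V) ` \<W>)" by (simp add: sat_def)
      have "a \<lhd> U" by (rule tr[OF a]) (use US cover_refl in auto)
      moreover have "a \<lhd> \<Union>\<W>" by (rule tr[OF a]) (use sS cover_refl in auto)
      ultimately show "a \<in> U \<inter> sat S cov (\<Union>\<W>)" using US by (auto simp: sat_def UA)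
    qed
    also have "\<dots> = sat_join S cov ((\<lambda>V. sat_op S cov (down_op S le) U V) ` \<W>)"
      by (simp add: sat_join_def opW)
    finally show "sat_op S cov (down_op S le) U (sat_join S cov \<W>) =
              sat_join S cov ((\<lambda>V. sat_op S cov (down_op S le) U V) ` \<W>)" .
    show "sat_op S cov (down_op S le) U V = sat_op S cov (down_op S le) V U"
      using US V by (auto simp: sat_op_def sat_def op d2)
  qed
  show ?thesis
  proof
    show "down_op S le \<in> Pow S \<rightarrow>\<^sub>E Pow S \<rightarrow>\<^sub>E Pow S"
      using dS by (auto simp: down_op_def)
  next
    fix U1 U2 V1 V2
    assume "U1 \<subseteq> S" "U2 \<subseteq> S" "V1 \<subseteq> S" "V2 \<subseteq> S" "covers_set cov U1 V1" "covers_set cov U2 V2"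
    then show "covers_set cov (down_op S le U1 U2) (down_op S le V1 V2)"
      by (auto simp: covers_set_def op d2 intro: tr[OF d1(1)] tr[OF d1(2)])
  next
    fix U V W assume "U \<subseteq> S" "V \<subseteq> S" "W \<subseteq> S"
    then show "covers_set cov (down_op S le (down_op S le U V) W) (down_op S le U (down_op S le V W))"
      by (simp add: covers_set_def op dS d2) (meson d1 d2 dS tr)
  next
    fix U V assume "U \<subseteq> S" "V \<subseteq> S"
    then show "covers_set cov (down_op S le U V) (down_op S le V U)"
      by (auto simp: covers_set_def op d2 intro: d1)
  next
    fix U \<W> assume U: "U \<in> Sat S cov" and W: "\<W> \<subseteq> Sat S cov"
    show 1: "sat_op S cov (down_op S le) U (sat_join S cov \<W>) =
          sat_join S cov ((\<lambda>V. sat_op S cov (down_op S le) U V) ` \<W>)"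
      by (rule dist[OF U W subset_refl])
    have "(\<lambda>V. sat_op S cov (down_op S le) V U) ` \<W> = (\<lambda>V. sat_op S cov (down_op S le) U V) ` \<W>"
      using W comm[OF U W] by (intro image_cong) (auto simp: Sat_def)
    then show "sat_op S cov (down_op S le) (sat_join S cov \<W>) U =
          sat_join S cov ((\<lambda>V. sat_op S cov (down_op S le) V U) ` \<W>)"
      using 1 comm[OF U W, of "sat_join S cov \<W>"] satS by (simp add: sat_join_def)
  next
    fix U V assume "U \<subseteq> S" "V \<subseteq> S"
    then show "sat S cov (down_op S le U V) = sat S cov U \<inter> sat S cov V"
      by (auto simp: sat_def op d2)
  qed
qed

lemma (in cov_formal_cover) le_formal_cover_cover_le: "le_formal_cover S cov (cover_le S cov)"
proof
  have tr: "a \<lhd> {b} \<Longrightarrow> b \<lhd> U \<Longrightarrow> a \<lhd> U" for a b U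
    using cover_trans[of U a "{b}"] cover_dom unfolding covers_set_def by blast
  show "preorder_on S (cover_le S cov)"
    unfolding preorder_on_def refl_on_def trans_def cover_le_def
    using tr cover_refl by auto
  show "\<And>a b U. (a, b) \<in> cover_le S cov \<Longrightarrow> b \<lhd> U \<Longrightarrow> a \<lhd> U"
    using tr by (auto simp: cover_le_def)
  show "\<And>a U V. a \<lhd> U \<Longrightarrow> a \<lhd> V \<Longrightarrow> a \<lhd> down S (cover_le S cov) U V"
    by (rule cov_right)
qed

lemma Ob_le_FCov_subset: "Ob le_FCov \<subseteq> Ob FCov"
  by (auto simp: le_FCov_def full_subcategory_def FCov_def
      intro: le_formal_cover.formal_cover_down_op)

lemma Ob_cov_FCov_subset: "Ob cov_FCov \<subseteq> Ob le_FCov"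
  by (auto simp: le_FCov_def cov_FCov_def full_subcategory_def
      intro: cov_formal_cover.le_formal_cover_cover_le)

end

theory Submission
  imports Defs
begin

text \<open>
  In a formal cover, \<open>U \<circ> V\<close> has the same saturation as every other operation representing the meet
  \<open>\<A> U \<inter> \<A> V\<close>, so the operation carries no information beyond the cover.  Two facts make this
  precise.

  First, the cover of any formal cover satisfies the defining condition of a \<open>\<lhd>\<close>-formal cover
  (lemma \<open>formal_cover.cov_formal_cover\<close>).  Since \<open>\<circ>\<close> distributes over joins, \<open>Sat\<close> is a frame, whence
  \<open>\<A> U \<inter> \<A> V\<close> is the join of the sets \<open>\<A> {u} \<inter> \<A> {v}\<close> with \<open>u \<in> U\<close> and \<open>v \<in> V\<close>; each of these is the
  set of common lower bounds of \<open>u\<close> and \<open>v\<close> for the preorder \<open>a \<lhd> {b}\<close>.  Hence the operation of a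
  formal cover may be replaced by \<open>\<down>\<close> without touching the cover.

  Second, formal cover maps and their equality are determined by the covers of source and target: a
  formal cover map is a relation whose inverse image preserves covers, finite meets of saturated sets
  and the top (lemma \<open>formal_cover_map_iff\<close>).  Therefore the identity relation is an isomorphism
  between two formal covers with the same cover (lemma \<open>isomorphism_FCov_same_cover\<close>).

  Together, every formal cover is isomorphic to a \<open>\<lhd>\<close>-formal cover.  The inclusions of \<open>\<lhd>\<close>-formal
  covers into \<open>\<le>\<close>-formal covers and of those into all formal covers are thus full, faithful and
  essentially surjective, that is, equivalences.  The same description of formal cover maps makes
  closure under composition immediate, so that formal covers do form a category.
\<close>

section \<open>Equivalences of categories\<close>

lemma full_subcategory_simps [simp]:
  "Ob (full_subcategory C A) = A"
  "Hom (full_subcategory C A) = Hom C"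
  "Ident (full_subcategory C A) = Ident C"
  "Comp (full_subcategory C A) = Comp C"
  by (simp_all add: full_subcategory_def)

lemma full_subcategory_full_subcategory [simp]:
  "full_subcategory (full_subcategory C A) B = full_subcategory C B"
  by (simp add: full_subcategory_def)

lemma isomorphism_full_subcategory [simp]:
  "isomorphism (full_subcategory C A) = isomorphism C"
  by (simp add: isomorphism_def fun_eq_iff)

lemma category_full_subcategory:
  assumes "category C" "A \<subseteq> Ob C"
  shows "category (full_subcategory C A)"
proof -
  interpret category C by fact
  show ?thesis
    by unfold_locales
      (use assms(2) in \<open>auto simp: subset_iff Ident_in_Hom Comp_Ident_left Comp_Ident_right
         intro: Comp_in_Hom Comp_assoc\<close>)
qed

lemma natural_isomorphism_inverse:
  assumes D: "category D" and F: "is_functor C D F" and G: "is_functor C D G"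
    and \<eta>: "natural_isomorphism C D F G \<eta>"
  shows "\<exists>\<theta>. natural_isomorphism C D G F \<theta>"
proof -
  interpret D: category D by fact
  interpret F: is_functor C D F by fact
  interpret G: is_functor C D G by fact
  have "\<forall>X\<in>Ob C. \<exists>g. g \<in> Hom D (fobj G X) (fobj F X) \<and>
      Comp D (fobj F X) (fobj G X) (fobj F X) g (\<eta> X) = Ident D (fobj F X) \<and>
      Comp D (fobj G X) (fobj F X) (fobj G X) (\<eta> X) g = Ident D (fobj G X)"
    using \<eta> by (auto simp: natural_isomorphism_def isomorphism_def)
  then obtain \<theta> where \<theta>: "\<And>X. X \<in> Ob C \<Longrightarrow> \<theta> X \<in> Hom D (fobj G X) (fobj F X)"
      "\<And>X. X \<in> Ob C \<Longrightarrow> Comp D (fobj F X) (fobj G X) (fobj F X) (\<theta> X) (\<eta> X) = Ident D (fobj F X)"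
      "\<And>X. X \<in> Ob C \<Longrightarrow> Comp D (fobj G X) (fobj F X) (fobj G X) (\<eta> X) (\<theta> X) = Ident D (fobj G X)"
    by (metis (no_types, lifting))
  have \<eta>_Hom: "\<eta> X \<in> Hom D (fobj F X) (fobj G X)" if "X \<in> Ob C" for X
    using \<eta> that by (auto simp: natural_isomorphism_def isomorphism_def)
  have "Comp D (fobj G X) (fobj G Y) (fobj F Y) (\<theta> Y) (fhom G X Y f) =
      Comp D (fobj G X) (fobj F X) (fobj F Y) (fhom F X Y f) (\<theta> X)"
    if X: "X \<in> Ob C" and Y: "Y \<in> Ob C" and f: "f \<in> Hom C X Y" for X Y f
  proof -
    note ob = F.fobj_in_Ob[OF X] F.fobj_in_Ob[OF Y] G.fobj_in_Ob[OF X] G.fobj_in_Ob[OF Y]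
    note hom = \<theta>(1)[OF X] \<theta>(1)[OF Y] \<eta>_Hom[OF X] \<eta>_Hom[OF Y]
      F.fhom_in_Hom[OF X Y f] G.fhom_in_Hom[OF X Y f]
    let ?c = "\<lambda>A B E. Comp D A B E"
    let ?FX = "fobj F X" and ?FY = "fobj F Y" and ?GX = "fobj G X" and ?GY = "fobj G Y"
    let ?Ff = "fhom F X Y f" and ?Gf = "fhom G X Y f"
    have nat: "?c ?FX ?FY ?GY (\<eta> Y) ?Ff = ?c ?FX ?GX ?GY ?Gf (\<eta> X)"
      using \<eta> X Y f by (auto simp: natural_isomorphism_def)
    have "?c ?GX ?GY ?FY (\<theta> Y) ?Gf
        = ?c ?GX ?GY ?FY (\<theta> Y) (?c ?GX ?GX ?GY ?Gf (?c ?GX ?FX ?GX (\<eta> X) (\<theta> X)))"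
      by (simp add: \<theta>(3) X D.Comp_Ident_right ob hom)
    also have "\<dots> = ?c ?GX ?GY ?FY (\<theta> Y) (?c ?GX ?FX ?GY (?c ?FX ?GX ?GY ?Gf (\<eta> X)) (\<theta> X))"
      by (subst D.Comp_assoc[OF ob(3,1,3,4) hom(1,3,6)]) simp
    also have "\<dots> = ?c ?GX ?GY ?FY (\<theta> Y) (?c ?GX ?FX ?GY (?c ?FX ?FY ?GY (\<eta> Y) ?Ff) (\<theta> X))"
      by (simp only: nat)
    also have "\<dots> = ?c ?GX ?GY ?FY (\<theta> Y) (?c ?GX ?FY ?GY (\<eta> Y) (?c ?GX ?FX ?FY ?Ff (\<theta> X)))"
      by (subst D.Comp_assoc[OF ob(3,1,2,4) hom(1,5,4)]) simp
    also have "\<dots> = ?c ?GX ?FY ?FY (?c ?FY ?GY ?FY (\<theta> Y) (\<eta> Y)) (?c ?GX ?FX ?FY ?Ff (\<theta> X))"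
      by (subst D.Comp_assoc[OF ob(3,2,4,2) D.Comp_in_Hom[OF ob(3,1,2) hom(1,5)] hom(4,2)]) simp
    also have "\<dots> = ?c ?GX ?FX ?FY ?Ff (\<theta> X)"
      by (simp add: \<theta>(2) Y D.Comp_Ident_left D.Comp_in_Hom ob hom)
    finally show ?thesis .
  qed
  moreover have "isomorphism D (fobj G X) (fobj F X) (\<theta> X)" if "X \<in> Ob C" for X
    unfolding isomorphism_def using \<theta>[OF that] \<eta>_Hom[OF that] by blast
  ultimately have "natural_isomorphism C D G F \<theta>" by (simp add: natural_isomorphism_def)
  then show ?thesis by blast
qed

lemma is_functor_id_functor: "is_functor C C id_functor"
  by unfold_locales (auto simp: id_functor_def)

lemma is_functor_comp_functor:
  assumes "is_functor C D F" "is_functor D E G"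
  shows "is_functor C E (comp_functor G F)"
proof -
  interpret F: is_functor C D F by fact
  interpret G: is_functor D E G by fact
  show ?thesis
    by unfold_locales
      (auto simp: comp_functor_def F.fobj_in_Ob G.fobj_in_Ob F.fhom_in_Hom G.fhom_in_Hom
        F.fhom_Ident G.fhom_Ident F.fhom_Comp G.fhom_Comp)
qed

lemma equivalent_categories_sym:
  assumes "equivalent_categories C D"
  shows "equivalent_categories D C"
proof -
  obtain F G \<eta> \<epsilon> where *: "category C" "category D" "is_functor C D F" "is_functor D C G"
      "natural_isomorphism C C id_functor (comp_functor G F) \<eta>"
      "natural_isomorphism D D (comp_functor F G) id_functor \<epsilon>"
    using assms by (auto simp: equivalent_categories_def)
  have "\<exists>\<theta>. natural_isomorphism C C (comp_functor G F) id_functor \<theta>"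
    "\<exists>\<theta>. natural_isomorphism D D id_functor (comp_functor F G) \<theta>"
    using * by (blast intro: natural_isomorphism_inverse is_functor_id_functor
        is_functor_comp_functor)+
  with * show ?thesis unfolding equivalent_categories_def by blast
qed

text \<open>
  Choose an isomorphism \<open>i X\<close> from every object \<open>X\<close> to an object of \<open>A\<close>.  Conjugation by these
  isomorphisms is a quasi-inverse of the inclusion, and one natural isomorphism consists of the
  \<open>i X\<close>, the other of their inverses.
\<close>

lemma equivalent_categories_full_subcategory:
  assumes C: "category C" and A: "A \<subseteq> Ob C"
    and surj: "\<And>X. X \<in> Ob C \<Longrightarrow> \<exists>Y \<in> A. \<exists>f. isomorphism C X Y f"
  shows "equivalent_categories C (full_subcategory C A)"
proof -
  interpret category C by fact
  let ?c = "Comp C"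
  have "\<forall>X\<in>Ob C. \<exists>Y i j. Y \<in> A \<and> i \<in> Hom C X Y \<and> j \<in> Hom C Y X \<and>
      ?c X Y X j i = Ident C X \<and> ?c Y X Y i j = Ident C Y"
    using surj unfolding isomorphism_def by blast
  then obtain n i j where n: "\<And>X. X \<in> Ob C \<Longrightarrow> n X \<in> A"
    and i: "\<And>X. X \<in> Ob C \<Longrightarrow> i X \<in> Hom C X (n X)"
    and j: "\<And>X. X \<in> Ob C \<Longrightarrow> j X \<in> Hom C (n X) X"
    and ji: "\<And>X. X \<in> Ob C \<Longrightarrow> ?c X (n X) X (j X) (i X) = Ident C X"
    and ij: "\<And>X. X \<in> Ob C \<Longrightarrow> ?c (n X) X (n X) (i X) (j X) = Ident C (n X)"
    by (metis (no_types, lifting))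
  have nC: "\<And>X. X \<in> Ob C \<Longrightarrow> n X \<in> Ob C" using n A by blast
  have iso: "isomorphism C X (n X) (i X)" "isomorphism C (n X) X (j X)" if "X \<in> Ob C" for X
    using i j ij ji that unfolding isomorphism_def by blast+
  define conj where "conj X Y f = ?c (n X) Y (n Y) (i Y) (?c (n X) X Y f (j X))" for X Y f
  have fj: "?c (n X) X Y f (j X) \<in> Hom C (n X) Y" if "X \<in> Ob C" "Y \<in> Ob C" "f \<in> Hom C X Y" for X Y f
    by (intro Comp_in_Hom that nC j)
  have conj_Hom: "conj X Y f \<in> Hom C (n X) (n Y)"
    if "X \<in> Ob C" "Y \<in> Ob C" "f \<in> Hom C X Y" for X Y f
    unfolding conj_def by (intro Comp_in_Hom that nC j i)
  have j_conj: "?c (n X) (n Y) Y (j Y) (conj X Y f) = ?c (n X) X Y f (j X)"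
    if "X \<in> Ob C" "Y \<in> Ob C" "f \<in> Hom C X Y" for X Y f
    using Comp_assoc[OF nC[OF that(1)] that(2) nC[OF that(2)] that(2) fj[OF that]
        i[OF that(2)] j[OF that(2)]] that
    by (simp add: conj_def ji Comp_Ident_left nC fj)
  have conj_i: "?c X (n X) (n Y) (conj X Y f) (i X) = ?c X Y (n Y) (i Y) f"
    if "X \<in> Ob C" "Y \<in> Ob C" "f \<in> Hom C X Y" for X Y f
  proof -
    have "?c X (n X) Y (?c (n X) X Y f (j X)) (i X) = f"
      using Comp_assoc[OF that(1) nC[OF that(1)] that(1,2) i[OF that(1)] j[OF that(1)] that(3)] that
      by (simp add: ji Comp_Ident_right)
    then show ?thesis
      using Comp_assoc[OF that(1) nC[OF that(1)] that(2) nC[OF that(2)] i[OF that(1)] fj[OF that]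
          i[OF that(2)]] by (simp add: conj_def)
  qed
  have conj_Comp: "conj X Z (?c X Y Z g f) = ?c (n X) (n Y) (n Z) (conj Y Z g) (conj X Y f)"
    if X: "X \<in> Ob C" and Y: "Y \<in> Ob C" and Z: "Z \<in> Ob C"
      and f: "f \<in> Hom C X Y" and g: "g \<in> Hom C Y Z" for X Y Z f g
  proof -
    have "?c (n X) (n Y) (n Z) (conj Y Z g) (conj X Y f) =
        ?c (n X) Y (n Z) (?c Y (n Y) (n Z) (conj Y Z g) (i Y)) (?c (n X) X Y f (j X))"
      unfolding conj_def[of X Y f]
      by (rule Comp_assoc[symmetric]) (use X Y Z f g nC i fj conj_Hom in auto)
    also have "\<dots> = ?c (n X) Y (n Z) (?c Y Z (n Z) (i Z) g) (?c (n X) X Y f (j X))"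
      by (simp add: conj_i Y Z g)
    also have "\<dots> = ?c (n X) Z (n Z) (i Z) (?c (n X) Y Z g (?c (n X) X Y f (j X)))"
      by (rule Comp_assoc) (use X Y Z f g nC i fj in auto)
    also have "\<dots> = conj X Z (?c X Y Z g f)"
      unfolding conj_def
      by (subst Comp_assoc[of "n X" X Y Z "j X" f g]) (use X Y Z f g nC j in auto)
    finally show ?thesis by simp
  qed
  define G where "G = \<lparr>fobj = n, fhom = conj\<rparr>"
  have "is_functor C (full_subcategory C A) G"
  proof
    fix X assume X: "X \<in> Ob C"
    show "fhom G X X (Ident C X) = Ident (full_subcategory C A) (fobj G X)"
      using X by (simp add: G_def conj_def Comp_Ident_left nC j ij)
  qed (simp_all add: G_def n conj_Hom conj_Comp)
  moreover have "is_functor (full_subcategory C A) C id_functor"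
    by unfold_locales (use A in \<open>auto simp: id_functor_def\<close>)
  moreover have "natural_isomorphism C C id_functor (comp_functor id_functor G) i"
    using iso by (simp add: natural_isomorphism_def id_functor_def comp_functor_def G_def conj_i)
  moreover have "natural_isomorphism (full_subcategory C A) (full_subcategory C A)
      (comp_functor G id_functor) id_functor j"
    using iso subsetD[OF A]
    by (simp add: natural_isomorphism_def id_functor_def comp_functor_def G_def j_conj)
  ultimately show ?thesis
    using C category_full_subcategory[OF C A] unfolding equivalent_categories_def by blast
qed


section \<open>Saturation\<close>

context basic_cover
begin

lemma sat_subset: "sat S cov U \<subseteq> S"
  by (auto simp: sat_def)

lemma subset_sat: "U \<subseteq> S \<Longrightarrow> U \<subseteq> sat S cov U"
  by (auto simp: sat_def intro: cover_refl)

lemma covers_set_iff_subset_sat: "covers_set cov U V \<longleftrightarrow> U \<subseteq> sat S cov V"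
  using cover_dom by (auto simp: covers_set_def sat_def)

lemma sat_least:
  assumes "V \<subseteq> S" "U \<subseteq> sat S cov V"
  shows "sat S cov U \<subseteq> sat S cov V"
  using assms cover_trans[of V _ U] by (auto simp: covers_set_iff_subset_sat sat_def)

lemma sat_mono: "U \<subseteq> V \<Longrightarrow> V \<subseteq> S \<Longrightarrow> sat S cov U \<subseteq> sat S cov V"
  using sat_least subset_sat by blast

lemma sat_sat: "U \<subseteq> S \<Longrightarrow> sat S cov (sat S cov U) = sat S cov U"
  by (simp add: sat_least subset_sat sat_subset subset_antisym)

lemma sat_in_Sat: "U \<subseteq> S \<Longrightarrow> sat S cov U \<in> Sat S cov"
  by (simp add: Sat_def sat_sat sat_subset)

lemma sat_UN_sat:
  assumes "\<And>i. i \<in> I \<Longrightarrow> U i \<subseteq> S"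
  shows "sat S cov (\<Union>i\<in>I. sat S cov (U i)) = sat S cov (\<Union>i\<in>I. U i)"
proof (rule subset_antisym; rule sat_least)
  show "(\<Union>i\<in>I. sat S cov (U i)) \<subseteq> sat S cov (\<Union>i\<in>I. U i)"
    using assms by (intro UN_least sat_mono) auto
  show "(\<Union>i\<in>I. U i) \<subseteq> sat S cov (\<Union>i\<in>I. sat S cov (U i))"
  proof (rule order_trans)
    show "(\<Union>i\<in>I. U i) \<subseteq> (\<Union>i\<in>I. sat S cov (U i))" using assms by (intro UN_mono subset_sat) auto
    show "\<dots> \<subseteq> sat S cov (\<Union>i\<in>I. sat S cov (U i))" using sat_subset by (intro subset_sat UN_least)
  qed
  show "(\<Union>i\<in>I. U i) \<subseteq> S" "(\<Union>i\<in>I. sat S cov (U i)) \<subseteq> S"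
    using assms sat_subset by (auto intro!: UN_least)
qed

end


section \<open>Every formal cover satisfies the down-set condition for its canonical preorder\<close>

text \<open>
  As the operation induces the meet, its distributivity says that \<open>Sat\<close> is a frame.  The join in
  question is the one that presents \<open>\<A> U\<close> by the generators \<open>\<A> {u}\<close>.
\<close>

lemma (in formal_cover) Int_sat_eq_sat_UN:
  assumes A: "A \<in> Sat S cov" and U: "U \<subseteq> S"
  shows "A \<inter> sat S cov U = sat S cov (\<Union>u\<in>U. A \<inter> sat S cov {u})"
proof -
  have op: "sat_op S cov opr A V = A \<inter> V" if "V \<in> Sat S cov" for V
    using A that op_meet[of A V] by (simp add: sat_op_def Sat_def)
  let ?W = "(\<lambda>u. sat S cov {u}) ` U"
  have W: "?W \<subseteq> Sat S cov" using U by (auto intro: sat_in_Sat)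
  have join: "sat_join S cov ?W = sat S cov U"
    using sat_UN_sat[of U "\<lambda>u. {u}"] U by (simp add: sat_join_def subset_iff)
  have "A \<inter> sat S cov U = sat_op S cov opr A (sat_join S cov ?W)"
    by (simp add: join op sat_in_Sat U)
  also have "\<dots> = sat_join S cov ((\<lambda>V. A \<inter> V) ` ?W)"
    using op W by (simp add: op_distrib_left[OF A W] subset_iff cong: image_cong_simp)
  finally show ?thesis by (simp add: sat_join_def image_image)
qed

text \<open>
  Splitting first the second and then the first argument into generators leaves the meets
  \<open>\<A> {u} \<inter> \<A> {v}\<close>, and such a meet consists of the common lower bounds of \<open>u\<close> and \<open>v\<close>.
\<close>

lemma (in formal_cover) sat_Int_sat_subset_sat_down:
  assumes U: "U \<subseteq> S" and V: "V \<subseteq> S"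
  shows "sat S cov U \<inter> sat S cov V \<subseteq> sat S cov (down S (cover_le S cov) U V)"
proof -
  let ?D = "down S (cover_le S cov) U V"
  have D: "?D \<subseteq> S" by (auto simp: down_def)
  have gen: "sat S cov {v} \<inter> sat S cov {u} \<subseteq> ?D" if "u \<in> U" "v \<in> V" for u v
    using that U V by (auto simp: down_def cover_le_def sat_def)
  have "sat S cov U \<inter> sat S cov {v} \<subseteq> sat S cov ?D" if v: "v \<in> V" for v
  proof -
    have "sat S cov {v} \<in> Sat S cov" using v V by (intro sat_in_Sat) auto
    then have "sat S cov {v} \<inter> sat S cov U = sat S cov (\<Union>u\<in>U. sat S cov {v} \<inter> sat S cov {u})"
      by (rule Int_sat_eq_sat_UN[OF _ U])
    also have "\<dots> \<subseteq> sat S cov ?D" using gen[OF _ v] D by (intro sat_mono) auto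
    finally show ?thesis by auto
  qed
  then have "sat S cov (\<Union>v\<in>V. sat S cov U \<inter> sat S cov {v}) \<subseteq> sat S cov ?D"
    using D by (intro sat_least) auto
  then show ?thesis by (simp add: Int_sat_eq_sat_UN[OF sat_in_Sat[OF U] V])
qed

lemma (in formal_cover) cov_formal_cover: "cov_formal_cover S cov"
proof
  fix a U V assume a: "cov a U" "cov a V"
  then have "U \<subseteq> S" "V \<subseteq> S" "a \<in> sat S cov U \<inter> sat S cov V"
    using cover_dom by (simp_all add: sat_def)
  then have "a \<in> sat S cov (down S (cover_le S cov) U V)"
    using sat_Int_sat_subset_sat_down by blast
  then show "cov a (down S (cover_le S cov) U V)" by (simp add: sat_def)
qed


section \<open>Formal cover maps as frame homomorphisms\<close>

abbreviation satn :: "'a fcov \<Rightarrow> 'a set \<Rightarrow> 'a set" where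
  "satn X U \<equiv> sat (pts X) (cvr X) U"

abbreviation is_fcov :: "'a fcov \<Rightarrow> bool" where
  "is_fcov X \<equiv> formal_cover (pts X) (cvr X) (cop X)"

lemma is_fcovD: "is_fcov X \<Longrightarrow> basic_cover (pts X) (cvr X)"
  by (simp add: formal_cover_def)

lemma basic_cover_map_preimage_subset: "basic_cover_map X Y r \<Longrightarrow> r\<inverse> `` U \<subseteq> pts X"
  by (auto simp: basic_cover_map_def)

text \<open>
  Up to saturation, the inverse image along a basic cover map only depends on the saturation of its
  argument, so it induces a map from \<open>Sat\<close> of the target to \<open>Sat\<close> of the source.
\<close>

lemma basic_cover_map_sat_preimage_sat:
  assumes X: "basic_cover (pts X) (cvr X)" and Y: "basic_cover (pts Y) (cvr Y)"
    and r: "basic_cover_map X Y r" and U: "U \<subseteq> pts Y"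
  shows "satn X (r\<inverse> `` satn Y U) = satn X (r\<inverse> `` U)"
proof -
  interpret X: basic_cover "pts X" "cvr X" by fact
  interpret Y: basic_cover "pts Y" "cvr Y" by fact
  note sub = basic_cover_map_preimage_subset[OF r]
  have "r\<inverse> `` {b} \<subseteq> satn X (r\<inverse> `` U)" if "b \<in> satn Y U" for b
    using r that by (simp add: basic_cover_map_def X.covers_set_iff_subset_sat sat_def[of "pts Y"])
  then have "r\<inverse> `` satn Y U \<subseteq> satn X (r\<inverse> `` U)" by blast
  then have "satn X (r\<inverse> `` satn Y U) \<subseteq> satn X (r\<inverse> `` U)" by (rule X.sat_least[OF sub])
  moreover have "satn X (r\<inverse> `` U) \<subseteq> satn X (r\<inverse> `` satn Y U)"
    by (intro X.sat_mono sub Image_mono Y.subset_sat U subset_refl)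
  ultimately show ?thesis by blast
qed

lemma basic_cover_map_sat_preimage_cong:
  assumes "basic_cover (pts X) (cvr X)" "basic_cover (pts Y) (cvr Y)" "basic_cover_map X Y r"
    and "U \<subseteq> pts Y" "V \<subseteq> pts Y" "satn Y U = satn Y V"
  shows "satn X (r\<inverse> `` U) = satn X (r\<inverse> `` V)"
  using assms basic_cover_map_sat_preimage_sat by metis

text \<open>
  The operations enter the definition only through the meets that they induce, so they disappear, and
  what remains is the known object: the inverse image induces a frame homomorphism between the frames
  of saturated sets.  Joins are taken care of by the preservation of covers.  Passing from meets of
  generators to meets of arbitrary saturated sets uses that, in the source, \<open>\<A> U \<inter> \<A> V\<close> is covered
  by \<open>U \<down> V\<close>.
\<close>

lemma formal_cover_map_iff:
  assumes X: "is_fcov X" and Y: "is_fcov Y"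
  shows "formal_cover_map X Y r \<longleftrightarrow>
    basic_cover_map X Y r \<and>
    (\<forall>U V. U \<subseteq> pts Y \<longrightarrow> V \<subseteq> pts Y \<longrightarrow>
      satn X (r\<inverse> `` (satn Y U \<inter> satn Y V)) = satn X (r\<inverse> `` U) \<inter> satn X (r\<inverse> `` V)) \<and>
    satn X (r\<inverse> `` pts Y) = pts X"
    (is "_ \<longleftrightarrow> ?basic \<and> ?meet \<and> ?top")
proof (cases ?basic)
  case False then show ?thesis by (simp add: formal_cover_map_def)
next
  case r: True
  interpret X: formal_cover "pts X" "cvr X" "cop X" by fact
  interpret Y: formal_cover "pts Y" "cvr Y" "cop Y" by fact
  note sub = basic_cover_map_preimage_subset[OF r]
  have opX: "satn X (cop X (r\<inverse> `` U) (r\<inverse> `` V)) = satn X (r\<inverse> `` U) \<inter> satn X (r\<inverse> `` V)" for U V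
    by (rule X.op_meet[OF sub sub])
  have opY: "satn X (r\<inverse> `` (cop Y U V)) = satn X (r\<inverse> `` (satn Y U \<inter> satn Y V))"
    if "U \<subseteq> pts Y" "V \<subseteq> pts Y" for U V
  proof -
    have "cop Y U V \<subseteq> pts Y" using Y.op_closed that by (auto simp: PiE_def Pi_def)
    from basic_cover_map_sat_preimage_sat[OF X.basic_cover_axioms Y.basic_cover_axioms r this]
    show ?thesis by (simp add: Y.op_meet that)
  qed
  have top: "satn X (pts X) = pts X" using X.subset_sat X.sat_subset by blast
  let ?gen = "\<forall>b1\<in>pts Y. \<forall>b2\<in>pts Y. satn X (r\<inverse> `` (satn Y {b1} \<inter> satn Y {b2}))
      = satn X (r\<inverse> `` {b1}) \<inter> satn X (r\<inverse> `` {b2})"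
  have "?gen \<Longrightarrow> ?meet"
  proof (intro allI impI subset_antisym)
    fix U V assume U: "U \<subseteq> pts Y" and V: "V \<subseteq> pts Y"
    let ?M = "satn X (r\<inverse> `` (satn Y U \<inter> satn Y V))"
    have "?M \<subseteq> satn X (r\<inverse> `` satn Y U) \<inter> satn X (r\<inverse> `` satn Y V)"
      by (intro Int_greatest X.sat_mono sub Image_mono) auto
    then show "?M \<subseteq> satn X (r\<inverse> `` U) \<inter> satn X (r\<inverse> `` V)"
      using basic_cover_map_sat_preimage_sat[OF X.basic_cover_axioms Y.basic_cover_axioms r] U V
      by simp
    assume gen: ?gen
    \<comment> \<open>A common lower bound of a point over \<open>u\<close> and a point over \<open>v\<close> lies in the inverse image of
      \<open>\<A> {u} \<inter> \<A> {v}\<close> up to saturation, by preservation of meets of generators.\<close>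
    have "down (pts X) (cover_le (pts X) (cvr X)) (r\<inverse> `` U) (r\<inverse> `` V) \<subseteq> ?M"
    proof
      fix c assume "c \<in> down (pts X) (cover_le (pts X) (cvr X)) (r\<inverse> `` U) (r\<inverse> `` V)"
      then obtain u' v' u v where c: "c \<in> satn X {u'}" "c \<in> satn X {v'}"
        and uv: "u' \<in> r\<inverse> `` {u}" "v' \<in> r\<inverse> `` {v}" "u \<in> U" "v \<in> V"
        by (fastforce simp: down_def cover_le_def sat_def)
      have "c \<in> satn X (r\<inverse> `` {u}) \<inter> satn X (r\<inverse> `` {v})"
        using c uv sub X.sat_mono[of "{u'}" "r\<inverse> `` {u}"] X.sat_mono[of "{v'}" "r\<inverse> `` {v}"] by blast
      also have "\<dots> = satn X (r\<inverse> `` (satn Y {u} \<inter> satn Y {v}))" using gen uv U V by auto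
      also have "\<dots> \<subseteq> ?M"
        using uv U V by (intro X.sat_mono sub Image_mono Int_mono Y.sat_mono) auto
      finally show "c \<in> ?M" .
    qed
    from X.sat_least[OF sub this] X.sat_Int_sat_subset_sat_down[OF sub sub]
    show "satn X (r\<inverse> `` U) \<inter> satn X (r\<inverse> `` V) \<subseteq> ?M" by blast
  qed
  moreover have "?meet \<Longrightarrow> ?gen" by simp
  ultimately have "?meet \<longleftrightarrow> ?gen" by blast
  moreover have "formal_cover_map X Y r \<longleftrightarrow> ?gen \<and> ?top"
    using r by (simp add: formal_cover_map_def opX opY top)
  ultimately show ?thesis using r by blast
qed

lemma basic_cover_map_O:
  assumes X: "basic_cover (pts X) (cvr X)" and Y: "basic_cover (pts Y) (cvr Y)"
    and Z: "basic_cover (pts Z) (cvr Z)"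
    and r: "basic_cover_map X Y r" and s: "basic_cover_map Y Z s"
  shows "basic_cover_map X Z (r O s)"
proof -
  interpret X: basic_cover "pts X" "cvr X" by fact
  interpret Y: basic_cover "pts Y" "cvr Y" by fact
  have "r\<inverse> `` (s\<inverse> `` {b}) \<subseteq> satn X (r\<inverse> `` (s\<inverse> `` V))" if "cvr Z b V" for b V
  proof -
    have "s\<inverse> `` {b} \<subseteq> satn Y (s\<inverse> `` V)"
      using s that by (simp add: basic_cover_map_def Y.covers_set_iff_subset_sat)
    then have "r\<inverse> `` (s\<inverse> `` {b}) \<subseteq> r\<inverse> `` satn Y (s\<inverse> `` V)" by blast
    also have "\<dots> \<subseteq> satn X (r\<inverse> `` satn Y (s\<inverse> `` V))"
      by (rule X.subset_sat[OF basic_cover_map_preimage_subset[OF r]])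
    also have "\<dots> = satn X (r\<inverse> `` (s\<inverse> `` V))"
      by (rule basic_cover_map_sat_preimage_sat[OF X Y r basic_cover_map_preimage_subset[OF s]])
    finally show ?thesis .
  qed
  moreover have "r O s \<subseteq> pts X \<times> pts Z" using r s by (auto simp: basic_cover_map_def)
  ultimately show ?thesis
    by (simp add: basic_cover_map_def X.covers_set_iff_subset_sat converse_relcomp relcomp_Image)
qed

lemma formal_cover_map_O:
  assumes X: "is_fcov X" and Y: "is_fcov Y" and Z: "is_fcov Z"
    and r: "formal_cover_map X Y r" and s: "formal_cover_map Y Z s"
  shows "formal_cover_map X Z (r O s)"
proof -
  note rI = r[unfolded formal_cover_map_iff[OF X Y]] and sI = s[unfolded formal_cover_map_iff[OF Y Z]]
  have r': "basic_cover_map X Y r" and s': "basic_cover_map Y Z s" using rI sI by auto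
  note subs = basic_cover_map_preimage_subset[OF s']
  have sat: "satn X (r\<inverse> `` (s\<inverse> `` W)) = satn X (r\<inverse> `` satn Y (s\<inverse> `` W))" for W
    using basic_cover_map_sat_preimage_sat[OF is_fcovD[OF X] is_fcovD[OF Y] r' subs] by simp
  have "satn X (r\<inverse> `` (s\<inverse> `` (satn Z U \<inter> satn Z V)))
      = satn X (r\<inverse> `` (s\<inverse> `` U)) \<inter> satn X (r\<inverse> `` (s\<inverse> `` V))"
    if "U \<subseteq> pts Z" "V \<subseteq> pts Z" for U V
  proof -
    have "satn Y (s\<inverse> `` (satn Z U \<inter> satn Z V)) = satn Y (s\<inverse> `` U) \<inter> satn Y (s\<inverse> `` V)"
      using sI that by blast
    then have "satn X (r\<inverse> `` (s\<inverse> `` (satn Z U \<inter> satn Z V)))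
        = satn X (r\<inverse> `` (satn Y (s\<inverse> `` U) \<inter> satn Y (s\<inverse> `` V)))" by (simp add: sat)
    also have "\<dots> = satn X (r\<inverse> `` (s\<inverse> `` U)) \<inter> satn X (r\<inverse> `` (s\<inverse> `` V))"
      using rI subs by blast
    finally show ?thesis .
  qed
  moreover have "satn X (r\<inverse> `` (s\<inverse> `` pts Z)) = pts X" using rI sI by (simp add: sat)
  moreover have "basic_cover_map X Z (r O s)"
    by (rule basic_cover_map_O[OF is_fcovD[OF X] is_fcovD[OF Y] is_fcovD[OF Z] r' s'])
  ultimately show ?thesis
    by (simp add: formal_cover_map_iff[OF X Z] converse_relcomp relcomp_Image)
qed

lemma formal_cover_map_Id_on:
  assumes X: "is_fcov X"
  shows "formal_cover_map X X (Id_on (pts X))"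
proof -
  interpret X: formal_cover "pts X" "cvr X" "cop X" by fact
  have im: "(Id_on (pts X))\<inverse> `` U = U" if "U \<subseteq> pts X" for U using that by auto
  have "satn X (satn X U \<inter> satn X V) = satn X U \<inter> satn X V" if "U \<subseteq> pts X" "V \<subseteq> pts X" for U V
    using X.op_meet[OF that] X.op_closed that X.sat_sat[of "cop X U V"] by (auto simp: PiE_def Pi_def)
  moreover have "basic_cover_map X X (Id_on (pts X))"
    using X.cover_dom im by (simp add: basic_cover_map_def covers_set_def subset_iff Id_on_def)
  ultimately show ?thesis
    using X.sat_subset X.subset_sat[of "pts X"]
    by (simp add: formal_cover_map_iff[OF X X] im le_infI1 subset_antisym del: converse_Id_on)
qed


section \<open>The category of formal covers\<close>

lemma equiv_fcm_eq: "equiv (Collect (formal_cover_map X Y)) (fcm_eq X Y)"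
  by (auto simp: equiv_def refl_on_def sym_def trans_def fcm_eq_def)

text \<open>Equality of maps is tested on points, but inverse images preserve unions and saturation turns
  them into joins.\<close>

lemma fcm_eq_sat_preimage:
  assumes X: "is_fcov X" and rs: "(r, s) \<in> fcm_eq X Y" and U: "U \<subseteq> pts Y"
  shows "satn X (r\<inverse> `` U) = satn X (s\<inverse> `` U)"
proof -
  interpret X: formal_cover "pts X" "cvr X" "cop X" by fact
  have "satn X (q\<inverse> `` U) = satn X (\<Union>b\<in>U. satn X (q\<inverse> `` {b}))" if "formal_cover_map X Y q" for q
  proof -
    have "q\<inverse> `` {b} \<subseteq> pts X" for b
      using that basic_cover_map_preimage_subset unfolding formal_cover_map_def by blast
    from X.sat_UN_sat[of U "\<lambda>b. q\<inverse> `` {b}", OF this] show ?thesis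
      by (simp add: Image_eq_UN[of _ U])
  qed
  moreover have "(\<Union>b\<in>U. satn X (r\<inverse> `` {b})) = (\<Union>b\<in>U. satn X (s\<inverse> `` {b}))"
    using rs U by (intro SUP_cong) (auto simp: fcm_eq_def)
  ultimately show ?thesis using rs by (simp add: fcm_eq_def)
qed

text \<open>
  Relational composition is well defined on classes: \<open>r\<close> may be replaced because equal maps agree on
  all subsets, and \<open>s\<close> because the inverse image along \<open>r'\<close> respects equality of saturations.
\<close>

lemma fcm_eq_O:
  assumes X: "is_fcov X" and Y: "is_fcov Y" and Z: "is_fcov Z"
    and r: "(r, r') \<in> fcm_eq X Y" and s: "(s, s') \<in> fcm_eq Y Z"
  shows "(r O s, r' O s') \<in> fcm_eq X Z"
proof -
  have maps: "formal_cover_map X Y r" "formal_cover_map X Y r'" "formal_cover_map Y Z s"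
    "formal_cover_map Y Z s'"
    using r s by (auto simp: fcm_eq_def)
  then have b: "basic_cover_map X Y r'" "basic_cover_map Y Z s" "basic_cover_map Y Z s'"
    by (auto simp: formal_cover_map_def)
  have "satn X (r\<inverse> `` (s\<inverse> `` {b})) = satn X (r'\<inverse> `` (s'\<inverse> `` {b}))" if "b \<in> pts Z" for b
  proof -
    have "satn X (r\<inverse> `` (s\<inverse> `` {b})) = satn X (r'\<inverse> `` (s\<inverse> `` {b}))"
      by (rule fcm_eq_sat_preimage[OF X r basic_cover_map_preimage_subset[OF b(2)]])
    also have "\<dots> = satn X (r'\<inverse> `` (s'\<inverse> `` {b}))"
      using s that by (intro basic_cover_map_sat_preimage_cong[OF is_fcovD[OF X] is_fcovD[OF Y] b(1)]
          basic_cover_map_preimage_subset[OF b(2)] basic_cover_map_preimage_subset[OF b(3)])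
        (auto simp: fcm_eq_def)
    finally show ?thesis .
  qed
  then show ?thesis
    using formal_cover_map_O[OF X Y Z maps(1,3)] formal_cover_map_O[OF X Y Z maps(2,4)]
    by (simp add: fcm_eq_def converse_relcomp relcomp_Image)
qed

lemma Ob_FCov: "X \<in> Ob FCov \<longleftrightarrow> is_fcov X"
  by (simp add: FCov_def)

lemma Hom_FCov: "f \<in> Hom FCov X Y \<longleftrightarrow> (\<exists>r. formal_cover_map X Y r \<and> f = fcm_eq X Y `` {r})"
  by (auto simp: FCov_def quotient_def)

lemma Ident_FCov: "Ident FCov X = fcm_eq X X `` {Id_on (pts X)}"
  by (simp add: FCov_def)

lemma Comp_FCov:
  assumes X: "is_fcov X" and Y: "is_fcov Y" and Z: "is_fcov Z"
    and r: "formal_cover_map X Y r" and s: "formal_cover_map Y Z s"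
  shows "Comp FCov X Y Z (fcm_eq Y Z `` {s}) (fcm_eq X Y `` {r}) = fcm_eq X Z `` {r O s}"
proof -
  let ?P = "{r' O s' | r' s'. r' \<in> fcm_eq X Y `` {r} \<and> s' \<in> fcm_eq Y Z `` {s}}"
  have "fcm_eq X Z `` {p} = fcm_eq X Z `` {r O s}" if "p \<in> ?P" for p
  proof -
    from that have "(r O s, p) \<in> fcm_eq X Z" using fcm_eq_O[OF X Y Z] by auto
    from equiv_class_eq[OF equiv_fcm_eq this] show ?thesis by (rule sym)
  qed
  moreover have "r O s \<in> ?P"
    using r s by (auto simp: fcm_eq_def)
  ultimately have "fcm_eq X Z `` ?P = fcm_eq X Z `` {r O s}"
    unfolding Image_eq_UN[of _ ?P] by blast
  then show ?thesis by (simp add: FCov_def)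
qed

lemma category_FCov: "category FCov"
proof
  fix X :: "'a fcov" assume "X \<in> Ob FCov"
  then show "Ident FCov X \<in> Hom FCov X X"
    by (auto simp: Ob_FCov Hom_FCov Ident_FCov intro: formal_cover_map_Id_on)
next
  fix X Y Z :: "'a fcov" and f g
  assume "X \<in> Ob FCov" "Y \<in> Ob FCov" "Z \<in> Ob FCov" and fg: "f \<in> Hom FCov X Y" "g \<in> Hom FCov Y Z"
  then have XYZ: "is_fcov X" "is_fcov Y" "is_fcov Z" by (simp_all add: Ob_FCov)
  obtain r s where rs: "formal_cover_map X Y r" "formal_cover_map Y Z s"
    and eq: "f = fcm_eq X Y `` {r}" "g = fcm_eq Y Z `` {s}"
    using fg by (auto simp: Hom_FCov)
  have "Comp FCov X Y Z g f = fcm_eq X Z `` {r O s}" unfolding eq by (rule Comp_FCov[OF XYZ rs])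
  with formal_cover_map_O[OF XYZ rs] show "Comp FCov X Y Z g f \<in> Hom FCov X Z"
    unfolding Hom_FCov by blast
next
  fix X Y :: "'a fcov" and f
  assume XY: "X \<in> Ob FCov" "Y \<in> Ob FCov" and "f \<in> Hom FCov X Y"
  then obtain r where r: "formal_cover_map X Y r" and f: "f = fcm_eq X Y `` {r}"
    by (auto simp: Hom_FCov)
  have "r \<subseteq> pts X \<times> pts Y" using r by (auto simp: formal_cover_map_def basic_cover_map_def)
  then have "Id_on (pts X) O r = r" "r O Id_on (pts Y) = r" by auto
  then show "Comp FCov X Y Y (Ident FCov Y) f = f" "Comp FCov X X Y f (Ident FCov X) = f"
    using XY r by (simp_all add: f Ob_FCov Ident_FCov Comp_FCov formal_cover_map_Id_on)
next
  fix W X Y Z :: "'a fcov" and f g h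
  assume "W \<in> Ob FCov" "X \<in> Ob FCov" "Y \<in> Ob FCov" "Z \<in> Ob FCov"
    and "f \<in> Hom FCov W X" "g \<in> Hom FCov X Y" "h \<in> Hom FCov Y Z"
  then show "Comp FCov W X Z (Comp FCov X Y Z h g) f = Comp FCov W Y Z h (Comp FCov W X Y g f)"
    by (auto simp: Ob_FCov Hom_FCov Comp_FCov formal_cover_map_O O_assoc)
qed

text \<open>
  Formal cover maps and their equality only see the points and the cover, so the identity relation
  is an isomorphism between any two formal covers that differ in the operation.
\<close>

lemma isomorphism_FCov_same_cover:
  assumes X: "is_fcov X" and Y: "is_fcov Y" and eq: "pts Y = pts X" "cvr Y = cvr X"
  shows "isomorphism FCov X Y (Ident FCov X)"
proof -
  have basic: "basic_cover_map X Y = basic_cover_map X X" "basic_cover_map Y X = basic_cover_map X X"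
    "basic_cover_map Y Y = basic_cover_map X X"
    by (simp_all add: basic_cover_map_def eq fun_eq_iff)
  have maps: "formal_cover_map X Y = formal_cover_map X X" "formal_cover_map Y X = formal_cover_map X X"
    "formal_cover_map Y Y = formal_cover_map X X"
    by (intro ext, simp only: formal_cover_map_iff[OF X X] formal_cover_map_iff[OF X Y]
        formal_cover_map_iff[OF Y X] formal_cover_map_iff[OF Y Y] basic eq)+
  then have fcm: "fcm_eq X Y = fcm_eq X X" "fcm_eq Y X = fcm_eq X X" "fcm_eq Y Y = fcm_eq X X"
    by (simp_all add: fcm_eq_def eq)
  interpret category FCov by (rule category_FCov)
  have Id: "Ident FCov X \<in> Hom FCov X X"
    and "Comp FCov X X X (Ident FCov X) (Ident FCov X) = Ident FCov X"
    using X by (simp_all add: Ob_FCov Ident_in_Hom Comp_Ident_left)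
  moreover have "Hom FCov X Y = Hom FCov X X" "Hom FCov Y X = Hom FCov X X"
    "Comp FCov X Y X = Comp FCov X X X" "Comp FCov Y X Y = Comp FCov X X X"
    "Ident FCov Y = Ident FCov X"
    by (simp_all add: FCov_def maps fcm eq)
  ultimately show ?thesis by (auto simp: isomorphism_def)
qed

lemma isomorphic_to_cov_FCov:
  assumes X: "X \<in> Ob FCov"
  shows "\<exists>Y \<in> Ob cov_FCov. \<exists>f. isomorphism FCov X Y f"
proof -
  interpret X: formal_cover "pts X" "cvr X" "cop X" using X by (simp add: Ob_FCov)
  let ?Y = "\<lparr>pts = pts X, cvr = cvr X, cop = down_op (pts X) (cover_le (pts X) (cvr X))\<rparr>"
  have Y: "?Y \<in> Ob cov_FCov" using X.cov_formal_cover unfolding cov_FCov_def full_subcategory_def by auto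
  then have "is_fcov ?Y" using Ob_cov_FCov_subset Ob_le_FCov_subset Ob_FCov by blast
  with X have "isomorphism FCov X ?Y (Ident FCov X)"
    by (intro isomorphism_FCov_same_cover) (simp_all add: Ob_FCov)
  with Y show ?thesis by blast
qed

theorem proposition6p9:
  shows "equivalent_categories
           (le_FCov :: ('a fcov, ('a \<times> 'a) set set) precategory)
           (cov_FCov :: ('a fcov, ('a \<times> 'a) set set) precategory) \<and>
         equivalent_categories
           (le_FCov :: ('a fcov, ('a \<times> 'a) set set) precategory)
           (FCov :: ('a fcov, ('a \<times> 'a) set set) precategory)"
proof
  let ?L = "le_FCov :: ('a fcov, ('a \<times> 'a) set set) precategory"
  let ?N = "cov_FCov :: ('a fcov, ('a \<times> 'a) set set) precategory"
  let ?F = "FCov :: ('a fcov, ('a \<times> 'a) set set) precategory"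
  have le: "full_subcategory ?F (Ob ?L) = ?L"
    by (simp only: le_FCov_def full_subcategory_simps)
  have cov: "full_subcategory ?L (Ob ?N) = ?N"
    by (simp only: cov_FCov_def le_FCov_def full_subcategory_simps full_subcategory_full_subcategory)
  have "category (full_subcategory ?F (Ob ?L))"
    by (intro category_full_subcategory category_FCov Ob_le_FCov_subset)
  then have "category ?L" by (simp only: le)
  moreover have "\<exists>Y \<in> Ob ?N. \<exists>f. isomorphism ?L X Y f" if "X \<in> Ob ?L" for X
  proof -
    have "isomorphism ?L = isomorphism ?F" by (simp only: le_FCov_def isomorphism_full_subcategory)
    then show ?thesis using isomorphic_to_cov_FCov[of X] that Ob_le_FCov_subset by auto
  qed
  ultimately have "equivalent_categories ?L (full_subcategory ?L (Ob ?N))"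
    by (intro equivalent_categories_full_subcategory Ob_cov_FCov_subset)
  then show "equivalent_categories ?L ?N" by (simp only: cov)
  have "equivalent_categories ?F (full_subcategory ?F (Ob ?L))"
  proof (rule equivalent_categories_full_subcategory[OF category_FCov Ob_le_FCov_subset])
    fix X assume "X \<in> Ob ?F"
    then show "\<exists>Y \<in> Ob ?L. \<exists>f. isomorphism ?F X Y f"
      using isomorphic_to_cov_FCov[of X] Ob_cov_FCov_subset by blast
  qed
  then show "equivalent_categories ?L ?F"
    unfolding le by (rule equivalent_categories_sym)
qed

end
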